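(* Let $G$ be a semidirect product of $K \trianglelefteq G$ by $H \le G$ (so $G = HK$ and $H \cap K = 1$). Let $\mathcal{P}$ be the subgroup of $\operatorname{Aut}(G)$ consisting of all automorphisms of $G$ which leave both $H$ and $K$ invariant. Let $\gamma' : H \to \mathcal{P}$ be a relative gamma function on $H$ that satisfies $$\gamma'(h_1 h_2) = \gamma'(h_2)\gamma'(h_1) \quad \text{for all } h_1, h_2 \in H.$$ In particular, $\gamma'$ composed with the restriction to $H$ is a bi-GF on $H$. Then the map $\gamma : G \to \operatorname{Aut}(G)$ defined by $$\gamma(h k) = \gamma'(h), \quad \text{for } h \in H,\ k \in K,$$ is a bi-GF on $G$.
   Context: Maps act on the right and are written as exponents, and products of maps are composed left to right. An element of $\mathcal{P}$ acts on $H$ as some $d \in \operatorname{Aut}(H)$ and on $K$ as some $a \in \operatorname{Aut}(K)$; such pairs $(d,a)$ are exactly those satisfying $a^{-1}\iota(h)a = \iota(h^{d})$ for all $h \in H$, where $\iota(h) \in \operatorname{Aut}(K)$ is $k \mapsto h^{-1} k h$. For a group $G$ and a subgroup $A \le G$, a relative gamma function (RGF) on $A$ is a function $\gamma : A \to \operatorname{Aut}(G)$ such that $A$ is invariant under every $\gamma(a)$, $a\in A$, and $\gamma(g^{\gamma(h)} h) = \gamma(g)\gamma(h)$ for all $g,h \in A$. If $A = G$ it is called a gamma function (GF) on $G$. A bi-GF on $G$ is a gamma function $\gamma$ on $G$ which is an anti-homomorphism, i.e. $\gamma(xy) = \gamma(y)\gamma(x)$ for all $x,y \in G$; equivalently,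 a gamma function such that, with $x \circ y = x^{\gamma(y)} y$, both $(G,\cdot,\circ)$ and $(G,\circ,\cdot)$ are (right) skew braces. Here a (right) skew brace is a triple $(G,\cdot,\circ)$ where $(G,\cdot)$, $(G,\circ)$ are groups and $(x y) \circ z = (x \circ z) \cdot z^{-1} \cdot (y \circ z)$ for all $x,y,z\in G$, with $z^{-1}$ the inverse in $(G,\cdot)$. *)

theory Defs
  imports "HOL-Algebra.Coset" "HOL-Algebra.Bij"
begin

text \<open>
  Maps act on the right: the power of x by an automorphism f is the application f x, and the
  product of f and g means first f, then g. The multiplication of \<^const>\<open>AutoGroup\<close> is ordinary
  composition (apply the second factor first), hence the swapped arguments.
\<close>

definition aut_prod :: "('a, 'b) monoid_scheme \<Rightarrow> ('a \<Rightarrow> 'a) \<Rightarrow> ('a \<Rightarrow> 'a) \<Rightarrow> 'a \<Rightarrow> 'a"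
  where "aut_prod G f g = g \<otimes>\<^bsub>AutoGroup G\<^esub> f"

text \<open>
  Invariance is the equality of image and set, rather than inclusion of the image: only then do
  the automorphisms leaving a (possibly infinite) subgroup invariant form a group and restrict to
  automorphisms of that subgroup.
\<close>

definition invariant_auts :: "('a, 'b) monoid_scheme \<Rightarrow> 'a set \<Rightarrow> 'a set \<Rightarrow> ('a \<Rightarrow> 'a) set"
  where "invariant_auts G H K = {f \<in> auto G. f ` H = H \<and> f ` K = K}"

definition rel_gamma_fun :: "('a, 'b) monoid_scheme \<Rightarrow> 'a set \<Rightarrow> ('a \<Rightarrow> 'a \<Rightarrow> 'a) \<Rightarrow> bool"
  where "rel_gamma_fun G A \<gamma> \<longleftrightarrow>
    \<gamma> \<in> A \<rightarrow> auto G \<and>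
    (\<forall>a\<in>A. \<gamma> a ` A = A) \<and>
    (\<forall>g\<in>A. \<forall>h\<in>A. \<gamma> (\<gamma> h g \<otimes>\<^bsub>G\<^esub> h) = aut_prod G (\<gamma> g) (\<gamma> h))"

definition gamma_fun :: "('a, 'b) monoid_scheme \<Rightarrow> ('a \<Rightarrow> 'a \<Rightarrow> 'a) \<Rightarrow> bool"
  where "gamma_fun G \<gamma> \<longleftrightarrow> rel_gamma_fun G (carrier G) \<gamma>"

definition bi_gamma_fun :: "('a, 'b) monoid_scheme \<Rightarrow> ('a \<Rightarrow> 'a \<Rightarrow> 'a) \<Rightarrow> bool"
  where "bi_gamma_fun G \<gamma> \<longleftrightarrow>
    gamma_fun G \<gamma> \<and>
    (\<forall>x\<in>carrier G. \<forall>y\<in>carrier G. \<gamma> (x \<otimes>\<^bsub>G\<^esub> y) = aut_prod G (\<gamma> y) (\<gamma> x))"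

end

theory Submission
  imports Defs
begin

text \<open>
  Write x = h k and y = l m with h, l in H and k, m in K. An automorphism f leaving H and K
  invariant sends x to (f h)(f k), and K is normal, so the H-component of x y is h l, and that of
  (\<gamma>(y) x) y is (\<gamma>'(l) h) l. As \<gamma> depends on the H-component only, both identities for \<gamma> are
  those for \<gamma>'.
\<close>

text \<open>The multiplication of \<open>BijGroup\<close> is a function restricted to
  \<open>Bij\<close> in both arguments, so membership in \<open>auto\<close> is what allows it to be
  evaluated.\<close>

lemma aut_prod_eq_compose:
  assumes "f \<in> auto G" and "g \<in> auto G"
  shows "aut_prod G f g = compose (carrier G) g f"
  using assms by (auto simp: aut_prod_def AutoGroup_def BijGroup_def auto_def)

text \<open>Injectivity is inherited from \<open>f\<close>, surjectivity onto \<open>H\<close> is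
  the equality of image and set. \<open>restrict\<close> appears because elements of
  \<open>auto\<close> are extensional on the carrier.\<close>

lemma auto_restrict_subgroup:
  assumes H: "subgroup H G" and f: "f \<in> auto G" and img: "f ` H = H"
  shows "restrict f H \<in> auto (G\<lparr>carrier := H\<rparr>)"
proof -
  have HG: "H \<subseteq> carrier G"
    by (rule subgroup.subset[OF H])
  have hom: "f \<in> hom G G" and "inj_on f (carrier G)"
    using f by (auto simp: auto_def Bij_def bij_betw_def)
  then have "bij_betw f H H"
    using HG img by (auto simp: bij_betw_def intro: inj_on_subset)
  moreover have "restrict f H \<in> hom (G\<lparr>carrier := H\<rparr>) (G\<lparr>carrier := H\<rparr>)"
    using hom HG img subgroup.m_closed[OF H] by (auto simp: hom_def subset_iff)
  ultimately show ?thesis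
    by (simp add: auto_def Bij_def bij_betw_restrict_eq)
qed

lemma bi_gamma_fun_restrict:
  assumes H: "subgroup H G" and rgf: "rel_gamma_fun G H \<gamma>"
    and anti: "\<forall>x\<in>H. \<forall>y\<in>H. \<gamma> (x \<otimes>\<^bsub>G\<^esub> y) = aut_prod G (\<gamma> y) (\<gamma> x)"
  shows "bi_gamma_fun (G\<lparr>carrier := H\<rparr>) (\<lambda>h. restrict (\<gamma> h) H)"
proof -
  have HG: "H \<subseteq> carrier G"
    by (rule subgroup.subset[OF H])
  have aut: "\<gamma> h \<in> auto G" and img: "\<gamma> h ` H = H" if "h \<in> H" for h
    using rgf that by (auto simp: rel_gamma_fun_def)
  have gf: "\<gamma> (\<gamma> h g \<otimes>\<^bsub>G\<^esub> h) = aut_prod G (\<gamma> g) (\<gamma> h)" if "g \<in> H" "h \<in> H" for g h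
    using rgf that by (auto simp: rel_gamma_fun_def)
  have raut: "restrict (\<gamma> h) H \<in> auto (G\<lparr>carrier := H\<rparr>)" if "h \<in> H" for h
    using auto_restrict_subgroup[OF H aut[OF that] img[OF that]] .
  \<comment> \<open>Both sides are \<open>undefined\<close> off \<open>H\<close>. On
    \<open>H\<close> the inner value \<open>\<gamma> g x\<close> stays in \<open>H\<close>, so the
    outer map is never evaluated where its restriction differs from it.\<close>
  have rprod: "restrict (aut_prod G (\<gamma> g) (\<gamma> h)) H
      = aut_prod (G\<lparr>carrier := H\<rparr>) (restrict (\<gamma> g) H) (restrict (\<gamma> h) H)"
    if "g \<in> H" "h \<in> H" for g h
  proof -
    have "\<gamma> g x \<in> H" if "x \<in> H" for x
      using img[OF \<open>g \<in> H\<close>] that by blast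
    then show ?thesis
      unfolding aut_prod_eq_compose[OF aut[OF that(1)] aut[OF that(2)]]
        aut_prod_eq_compose[OF raut[OF that(1)] raut[OF that(2)]]
      using HG by (auto simp: compose_def fun_eq_iff)
  qed
  show ?thesis
    unfolding bi_gamma_fun_def gamma_fun_def rel_gamma_fun_def
    \<comment> \<open>Reversed, \<open>rprod\<close> turns a product of restrictions into the
      restriction of a product in \<open>G\<close>, where \<open>gf\<close> and \<open>anti\<close>
      apply.\<close>
    using raut img by (auto simp: gf anti rprod[symmetric])
qed

context group
begin

text \<open>Cancellation collects the factors from \<open>H\<close> on one side and those from
  \<open>K\<close> on the other; the common value lies in \<open>H \<inter> K\<close>.\<close>

lemma semidirect_factor_unique:
  assumes H: "subgroup H G" and K: "subgroup K G" and HK: "H \<inter> K = {\<one>}"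
    and "h \<in> H" "k \<in> K" "h' \<in> H" "k' \<in> K" and eq: "h \<otimes> k = h' \<otimes> k'"
  shows "h = h'"
proof -
  have c: "h \<in> carrier G" "k \<in> carrier G" "h' \<in> carrier G" "k' \<in> carrier G"
    using assms(4-7) subgroup.mem_carrier[OF H] subgroup.mem_carrier[OF K] by auto
  have "h = (h \<otimes> k) \<otimes> inv k"
    using c by (simp add: m_assoc)
  also have "\<dots> = h' \<otimes> (k' \<otimes> inv k)"
    using c by (simp add: eq m_assoc)
  finally have "inv h' \<otimes> h = k' \<otimes> inv k"
    using c inv_solve_left'[of "k' \<otimes> inv k" h' h] by simp
  moreover have "inv h' \<otimes> h \<in> H" and "k' \<otimes> inv k \<in> K"
    using assms(4-7) subgroup.m_closed[OF H] subgroup.m_inv_closed[OF H]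
      subgroup.m_closed[OF K] subgroup.m_inv_closed[OF K] by auto
  ultimately have "inv h' \<otimes> h = \<one>"
    by (metis HK IntI singletonD)
  then show ?thesis
    using c inv_solve_left'[of \<one> h' h] by simp
qed

text \<open>Moving \<open>k\<close> to the right past \<open>l\<close> replaces it by its conjugate
  under \<open>l\<close>, which normality keeps in \<open>K\<close>.\<close>

lemma semidirect_mult:
  assumes "K \<lhd> G" and "subgroup H G" and "h \<in> H" "k \<in> K" "l \<in> H" "m \<in> K"
  obtains n where "n \<in> K" and "(h \<otimes> k) \<otimes> (l \<otimes> m) = (h \<otimes> l) \<otimes> n"
proof
  interpret K: normal K G by fact
  have c: "h \<in> carrier G" "k \<in> carrier G" "l \<in> carrier G" "m \<in> carrier G"
    using assms(3-6) subgroup.mem_carrier[OF assms(2)] K.mem_carrier by auto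
  show "(inv l \<otimes> k \<otimes> l) \<otimes> m \<in> K"
    using assms c K.inv_op_closed1 by blast
  \<comment> \<open>This is the right-associated form that \<open>m_assoc\<close> produces in the
    goal below.\<close>
  have "l \<otimes> (inv l \<otimes> (k \<otimes> (l \<otimes> m))) = k \<otimes> (l \<otimes> m)"
    using c by (simp add: m_assoc[symmetric])
  then show "(h \<otimes> k) \<otimes> (l \<otimes> m) = (h \<otimes> l) \<otimes> ((inv l \<otimes> k \<otimes> l) \<otimes> m)"
    using c by (simp add: m_assoc)
qed

text \<open>This makes the formula for \<open>\<gamma>\<close> a legitimate definition: unique
  factorization gives existence, and extensionality fixes the values off the carrier.\<close>

lemma ex1_semidirect_extension:
  assumes H: "subgroup H G" and K: "subgroup K G" and HK: "H <#> K = carrier G"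
    and triv: "H \<inter> K = {\<one>}" and f: "f \<in> H \<rightarrow> B"
  shows "\<exists>!F. F \<in> carrier G \<rightarrow>\<^sub>E B \<and> (\<forall>h\<in>H. \<forall>k\<in>K. F (h \<otimes> k) = f h)"
proof (rule ex_ex1I)
  \<comment> \<open>The description picks the \<open>H\<close>-component of
    \<open>x\<close>.\<close>
  define F where "F = (\<lambda>x\<in>carrier G. f (THE h. h \<in> H \<and> (\<exists>k\<in>K. x = h \<otimes> k)))"
  have F: "F (h \<otimes> k) = f h" if "h \<in> H" "k \<in> K" for h k
  proof -
    have "(THE h'. h' \<in> H \<and> (\<exists>k'\<in>K. h \<otimes> k = h' \<otimes> k')) = h"
      using that semidirect_factor_unique[OF H K triv] by (intro the_equality) blast+
    moreover have "h \<otimes> k \<in> carrier G"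
      using that HK by (auto simp: set_mult_def)
    ultimately show ?thesis
      by (simp add: F_def)
  qed
  have "F x \<in> B" if "x \<in> carrier G" for x
    using that F f unfolding HK[symmetric] set_mult_def by auto
  then have "F \<in> carrier G \<rightarrow>\<^sub>E B"
    by (auto simp: F_def)
  with F show "\<exists>F. F \<in> carrier G \<rightarrow>\<^sub>E B \<and> (\<forall>h\<in>H. \<forall>k\<in>K. F (h \<otimes> k) = f h)"
    by blast
next
  fix F F'
  assume F: "F \<in> carrier G \<rightarrow>\<^sub>E B \<and> (\<forall>h\<in>H. \<forall>k\<in>K. F (h \<otimes> k) = f h)"
    and F': "F' \<in> carrier G \<rightarrow>\<^sub>E B \<and> (\<forall>h\<in>H. \<forall>k\<in>K. F' (h \<otimes> k) = f h)"
  show "F = F'"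
  proof (rule extensionalityI[where A = "carrier G"])
    show "F \<in> extensional (carrier G)" "F' \<in> extensional (carrier G)"
      using F F' by (auto simp: PiE_def)
    show "F x = F' x" if "x \<in> carrier G" for x
      using that F F' unfolding HK[symmetric] set_mult_def by auto
  qed
qed

text \<open>Here \<open>\<gamma>\<close> is any function satisfying the formula, with arbitrary
  values off the carrier: \<open>bi_gamma_fun\<close> evaluates it only at group elements.\<close>

lemma bi_gamma_fun_semidirect_extension:
  assumes K: "K \<lhd> G" and H: "subgroup H G" and HK: "H <#> K = carrier G"
    and inv: "\<gamma>' \<in> H \<rightarrow> invariant_auts G H K" and rgf: "rel_gamma_fun G H \<gamma>'"
    and anti: "\<forall>x\<in>H. \<forall>y\<in>H. \<gamma>' (x \<otimes> y) = aut_prod G (\<gamma>' y) (\<gamma>' x)"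
    and \<gamma>: "\<forall>h\<in>H. \<forall>k\<in>K. \<gamma> (h \<otimes> k) = \<gamma>' h"
  shows "bi_gamma_fun G \<gamma>"
proof -
  have aut: "\<gamma>' h \<in> auto G" and imgH: "\<gamma>' h ` H = H" and imgK: "\<gamma>' h ` K = K" if "h \<in> H" for h
    using inv that by (auto simp: invariant_auts_def)
  have factor: "\<exists>h\<in>H. \<exists>k\<in>K. x = h \<otimes> k" if "x \<in> carrier G" for x
    using that unfolding HK[symmetric] set_mult_def by blast
  have mult: "\<gamma> ((h \<otimes> k) \<otimes> (l \<otimes> m)) = \<gamma>' (h \<otimes> l)"
    if "h \<in> H" "k \<in> K" "l \<in> H" "m \<in> K" for h k l m
    using semidirect_mult[OF K H that] \<gamma> that subgroup.m_closed[OF H] by metis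
  \<comment> \<open>For the subgroup \<open>carrier G\<close>, invariance is just surjectivity of
    the automorphism.\<close>
  have "\<gamma> x \<in> auto G \<and> \<gamma> x ` carrier G = carrier G" if "x \<in> carrier G" for x
  proof -
    from factor[OF that] have "\<gamma> x \<in> auto G"
      using \<gamma> aut by auto
    then show ?thesis
      by (auto simp: auto_def Bij_def bij_betw_def)
  qed
  moreover have "\<gamma> (\<gamma> y x \<otimes> y) = aut_prod G (\<gamma> x) (\<gamma> y)
      \<and> \<gamma> (x \<otimes> y) = aut_prod G (\<gamma> y) (\<gamma> x)"
    if "x \<in> carrier G" and "y \<in> carrier G" for x y
  proof -
    obtain h k l m where x: "h \<in> H" "k \<in> K" "x = h \<otimes> k" and y: "l \<in> H" "m \<in> K" "y = l \<otimes> m"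
      using factor \<open>x \<in> carrier G\<close> \<open>y \<in> carrier G\<close> by metis
    have "\<gamma>' l \<in> hom G G"
      using aut[OF \<open>l \<in> H\<close>] by (simp add: auto_def)
    moreover have "h \<in> carrier G" "k \<in> carrier G"
      using x subgroup.mem_carrier[OF H] subgroup.mem_carrier[OF normal_imp_subgroup[OF K]]
      by auto
    ultimately have "\<gamma>' l (h \<otimes> k) = \<gamma>' l h \<otimes> \<gamma>' l k"
      by (simp add: hom_mult)
    \<comment> \<open>By invariance, \<open>\<gamma> y x\<close> is again an element of
      \<open>H\<close> times one of \<open>K\<close>, so \<open>mult\<close> evaluates
      \<open>\<gamma>\<close> at \<open>\<gamma> y x \<otimes> y\<close>.\<close>
    moreover have "\<gamma>' l h \<in> H" "\<gamma>' l k \<in> K"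
      using x y imgH imgK by blast+
    moreover have "\<gamma>' (\<gamma>' l h \<otimes> l) = aut_prod G (\<gamma>' h) (\<gamma>' l)"
      using rgf x y by (simp add: rel_gamma_fun_def)
    ultimately show ?thesis
      using x y \<gamma> anti by (simp add: mult)
  qed
  ultimately show ?thesis
    by (auto simp: bi_gamma_fun_def gamma_fun_def rel_gamma_fun_def)
qed

end

text \<open>The second conjunct justifies speaking of the map \<open>\<gamma>\<close>; the third
  covers that map in particular.\<close>

theorem proposition4p5:
  fixes G :: "('a, 'b) monoid_scheme" and H K :: "'a set" and \<gamma>' :: "'a \<Rightarrow> 'a \<Rightarrow> 'a"
  assumes "group G" and "K \<lhd> G" and "subgroup H G"
    and "H <#>\<^bsub>G\<^esub> K = carrier G" and "H \<inter> K = {\<one>\<^bsub>G\<^esub>}"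
    and "\<gamma>' \<in> H \<rightarrow> invariant_auts G H K"
    and "rel_gamma_fun G H \<gamma>'"
    and "\<forall>h\<^sub>1\<in>H. \<forall>h\<^sub>2\<in>H. \<gamma>' (h\<^sub>1 \<otimes>\<^bsub>G\<^esub> h\<^sub>2) = aut_prod G (\<gamma>' h\<^sub>2) (\<gamma>' h\<^sub>1)"
  shows "bi_gamma_fun (G\<lparr>carrier := H\<rparr>) (\<lambda>h. restrict (\<gamma>' h) H)
    \<and> (\<exists>!\<gamma>. \<gamma> \<in> carrier G \<rightarrow>\<^sub>E auto G \<and> (\<forall>h\<in>H. \<forall>k\<in>K. \<gamma> (h \<otimes>\<^bsub>G\<^esub> k) = \<gamma>' h))
    \<and> (\<forall>\<gamma>. (\<forall>h\<in>H. \<forall>k\<in>K. \<gamma> (h \<otimes>\<^bsub>G\<^esub> k) = \<gamma>' h) \<longrightarrow> bi_gamma_fun G \<gamma>)"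
proof -
  interpret group G by fact
  have K: "subgroup K G"
    by (rule normal_imp_subgroup[OF assms(2)])
  have "\<gamma>' \<in> H \<rightarrow> auto G"
    using assms(7) by (simp add: rel_gamma_fun_def)
  note ext = ex1_semidirect_extension[OF assms(3) K assms(4,5) this]
  note bi = bi_gamma_fun_semidirect_extension[OF assms(2-4,6-8)]
  show ?thesis
    using bi_gamma_fun_restrict[OF assms(3,7,8)] ext bi by blast
qed

end
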